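(* Let $\mathcal{S}_1$ and $\mathcal{S}_2$ be two disjoint complete hypersurfaces of $\mathbb{R}^{n+1}$, which can be noncompact and have boundaries. Define the function $h:\mathcal{S}_1\to\mathbb{R}\cup\{\infty\}$ as follows: for $a=(a_1,\dots,a_{n+1})\in\mathcal{S}_1$, $$h(a)=\min\{a_{n+1}-b_{n+1} : (a_1,\dots,a_n,b_{n+1})\in\mathcal{S}_2 \text{ and } b_{n+1}<a_{n+1}\}$$ if the set $\{b_{n+1} : b_{n+1}<a_{n+1}\text{ and }(a_1,\dots,a_n,b_{n+1})\in\mathcal{S}_2\}$ is nonempty, and $h(a)=\infty$ otherwise. Suppose that $h$ achieves a local finite minimum at $a\in\mathcal{S}_1$ and $b\in\mathcal{S}_2$ (that is, $h$ has a local minimum at $a$ with $h(a)<\infty$, and $b=(a_1,\dots,a_n,b_{n+1})\in\mathcal{S}_2$ satisfies $b_{n+1}<a_{n+1}$ and $h(a)=a_{n+1}-b_{n+1}$), where $a$ and $b$ are not in the respective boundaries of $\mathcal{S}_1$ and $\mathcal{S}_2$, and suppose that $\langle\nu_a,e_{n+1}\rangle\neq0$, where $\nu_a$ is the unit normal vector of $\mathcal{S}_1$ at $a$. Then $\mathcal{S}_1$ or $\mathcal{S}_2$ is not a part of a self-shrinker.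
   Context: A hypersurface $\Sigma\subset\mathbb{R}^{n+1}$ is a self-shrinker if it satisfies $H=\frac{\langle x,\nu\rangle}{2}$, where $\nu$ is the (outer) unit normal vector, $H=\operatorname{div}(\nu)$ is the mean curvature and $x$ is the position vector. Equivalently, $\{\sqrt{-t}\,\Sigma : t<0\}$ is a solution of the mean curvature flow $(\partial_t x)^{\bot}=-H\nu$. Coordinates are taken with respect to an orthonormal basis $(e_1,\dots,e_{n+1})$ of $\mathbb{R}^{n+1}$. *)

theory Defs
  imports "HOL-Analysis.Analysis"
begin

section \<open>Smooth maps\<close>

text \<open>Iterated Frechet differentiability along the standard basis. Intended for open \<open>U\<close>;
  the derivatives are two-sided.\<close>

primrec Ck_on :: "nat \<Rightarrow> ('a::euclidean_space \<Rightarrow> 'b::real_normed_vector) \<Rightarrow> 'a set \<Rightarrow> bool" where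
  "Ck_on 0 f U \<longleftrightarrow> continuous_on U f"
| "Ck_on (Suc k) f U \<longleftrightarrow>
     (\<forall>x\<in>U. f differentiable (at x)) \<and>
     (\<forall>i\<in>Basis. Ck_on k (\<lambda>x. frechet_derivative f (at x) i) U)"

definition smooth_on :: "('a::euclidean_space \<Rightarrow> 'b::real_normed_vector) \<Rightarrow> 'a set \<Rightarrow> bool" where
  "smooth_on f U \<longleftrightarrow> (\<forall>k. Ck_on k f U)"


section \<open>Embedded hypersurfaces with boundary\<close>

definition slice_chart_at :: "'a::euclidean_space set \<Rightarrow> 'a \<Rightarrow> 'a set \<Rightarrow> bool" where
  "slice_chart_at S p M \<longleftrightarrow>
     (\<exists>U V \<phi> \<psi>. open U \<and> open V \<and> p \<in> U \<and> homeomorphism U V \<phi> \<psi> \<and>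
        smooth_on \<phi> U \<and> smooth_on \<psi> V \<and> \<phi> p = 0 \<and> \<phi> ` (S \<inter> U) = M \<inter> V)"

text \<open>The local models are a hyperplane through the origin and a closed half of a hyperplane with
  the origin on its edge. Letting the hyperplane vary instead of fixing a coordinate one only
  amounts to composing the chart with a linear isomorphism.\<close>

definition hs_interior :: "'a::euclidean_space set \<Rightarrow> 'a set" where
  "hs_interior S = {p \<in> S. \<exists>u. u \<noteq> 0 \<and> slice_chart_at S p {y. u \<bullet> y = 0}}"

definition hs_boundary :: "'a::euclidean_space set \<Rightarrow> 'a set" where
  "hs_boundary S = {p \<in> S. \<exists>u w. u \<noteq> 0 \<and> w \<noteq> 0 \<and> u \<bullet> w = 0 \<and>
     slice_chart_at S p {y. u \<bullet> y = 0 \<and> w \<bullet> y \<ge> 0}}"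

definition hypersurface :: "'a::euclidean_space set \<Rightarrow> bool" where
  "hypersurface S \<longleftrightarrow> S = hs_interior S \<union> hs_boundary S"

text \<open>Completeness refers to the distance induced by the Riemannian metric of \<open>S\<close> and not to
  closedness in the ambient space (which is stronger for these hypersurfaces). Curves of class
  \<open>C1\<close> suffice, since their velocity may vanish: a piecewise \<open>C1\<close> curve can be reparametrised so
  that it stops at its corners. Points that cannot be joined have distance \<open>\<infinity>\<close>.\<close>

definition intrinsic_dist :: "'a::euclidean_space set \<Rightarrow> 'a \<Rightarrow> 'a \<Rightarrow> ereal" where
  "intrinsic_dist S x y =
     (INF \<gamma> \<in> {\<gamma>. \<gamma> C1_differentiable_on {0..1} \<and> path_image \<gamma> \<subseteq> S \<and>
                  pathstart \<gamma> = x \<and> pathfinish \<gamma> = y}.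
        ereal (integral {0..1} (\<lambda>t. norm (vector_derivative \<gamma> (at t)))))"

definition complete_hypersurface :: "'a::euclidean_space set \<Rightarrow> bool" where
  "complete_hypersurface S \<longleftrightarrow> hypersurface S \<and>
     (\<forall>x :: nat \<Rightarrow> 'a. (\<forall>k. x k \<in> S) \<longrightarrow>
        (\<forall>\<epsilon>>0. \<exists>N. \<forall>i\<ge>N. \<forall>j\<ge>N. intrinsic_dist S (x i) (x j) < ereal \<epsilon>) \<longrightarrow>
        (\<exists>l\<in>S. (\<lambda>k. intrinsic_dist S (x k) l) \<longlonglongrightarrow> 0))"


section \<open>Normals, mean curvature, self-shrinkers\<close>

text \<open>Velocities at time 0 are one-sided, so that at a boundary point they fill a half space, whose
  span is the full tangent space.\<close>

definition tangent_space :: "'a::euclidean_space set \<Rightarrow> 'a \<Rightarrow> 'a set" where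
  "tangent_space S p = span {v. \<exists>\<gamma>. pathstart \<gamma> = p \<and> path_image \<gamma> \<subseteq> S \<and>
     (\<gamma> has_vector_derivative v) (at 0 within {0..1})}"

definition unit_normal :: "'a::euclidean_space set \<Rightarrow> 'a \<Rightarrow> 'a \<Rightarrow> bool" where
  "unit_normal S p \<nu> \<longleftrightarrow> norm \<nu> = 1 \<and> (\<forall>v\<in>tangent_space S p. orthogonal \<nu> v)"

text \<open>A local unit normal field, extended to a unit vector field on an open subset of the ambient
  space. Since the extension has unit length, \<open>\<langle>D\<^sub>\<nu> \<nu>, \<nu>\<rangle> = 0\<close>, so its ambient divergence
  at points of \<open>S\<close> is the divergence along \<open>S\<close> and does not depend on the extension.\<close>

definition unit_normal_field :: "'a::euclidean_space set \<Rightarrow> 'a set \<Rightarrow> ('a \<Rightarrow> 'a) \<Rightarrow> bool" where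
  "unit_normal_field S U \<nu> \<longleftrightarrow> open U \<and> smooth_on \<nu> U \<and> (\<forall>x\<in>U. norm (\<nu> x) = 1) \<and>
     (\<forall>x\<in>S \<inter> U. unit_normal S x (\<nu> x))"

definition divergence :: "('a::euclidean_space \<Rightarrow> 'a) \<Rightarrow> 'a \<Rightarrow> real" where
  "divergence X p = (\<Sum>i\<in>Basis. frechet_derivative X (at p) i \<bullet> i)"

text \<open>The equation \<open>H = \<langle>x, \<nu>\<rangle> / 2\<close> with \<open>H = div \<nu>\<close> is invariant under \<open>\<nu> \<mapsto> -\<nu>\<close>, hence
  only local choices of the normal are needed.\<close>

definition self_shrinker :: "'a::euclidean_space set \<Rightarrow> bool" where
  "self_shrinker \<Sigma> \<longleftrightarrow> hypersurface \<Sigma> \<and>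
     (\<forall>p\<in>\<Sigma>. \<exists>U \<nu>. p \<in> U \<and> unit_normal_field \<Sigma> U \<nu> \<and>
        (\<forall>x\<in>\<Sigma> \<inter> U. divergence \<nu> x = (x \<bullet> \<nu> x) / 2))"

definition part_of_self_shrinker :: "'a::euclidean_space set \<Rightarrow> bool" where
  "part_of_self_shrinker S \<longleftrightarrow> (\<exists>\<Sigma>. self_shrinker \<Sigma> \<and> S \<subseteq> \<Sigma>)"


section \<open>The vertical gap\<close>

text \<open>Coordinates are \<open>x \<bullet> e i\<close> for \<open>i = 1, \<dots>, n + 1\<close>, the last one being the height.\<close>

definition strictly_below ::
    "nat \<Rightarrow> (nat \<Rightarrow> 'a::euclidean_space) \<Rightarrow> 'a \<Rightarrow> 'a \<Rightarrow> bool" where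
  "strictly_below n e b a \<longleftrightarrow>
     (\<forall>i\<in>{1..n}. b \<bullet> e i = a \<bullet> e i) \<and> b \<bullet> e (n + 1) < a \<bullet> e (n + 1)"

definition gaps_below ::
    "nat \<Rightarrow> (nat \<Rightarrow> 'a::euclidean_space) \<Rightarrow> 'a set \<Rightarrow> 'a \<Rightarrow> real set" where
  "gaps_below n e S2 a = {a \<bullet> e (n + 1) - b \<bullet> e (n + 1) | b. b \<in> S2 \<and> strictly_below n e b a}"

text \<open>Intrinsic completeness of \<open>S2\<close> does not ensure that a nonempty set of gaps has a least
  element, so the infimum is used; it is the minimum whenever there is one.\<close>

definition vertical_gap ::
    "nat \<Rightarrow> (nat \<Rightarrow> 'a::euclidean_space) \<Rightarrow> 'a set \<Rightarrow> 'a \<Rightarrow> ereal" where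
  "vertical_gap n e S2 a =
     (if gaps_below n e S2 a = {} then \<infinity> else ereal (Inf (gaps_below n e S2 a)))"

lemma vertical_gap_eq_minimum:
  assumes "d \<in> gaps_below n e S2 a" and "\<And>d'. d' \<in> gaps_below n e S2 a \<Longrightarrow> d \<le> d'"
  shows "vertical_gap n e S2 a = ereal d"
  using assms cInf_eq_minimum[of d "gaps_below n e S2 a"] by (auto simp: vertical_gap_def)

end

theory Submission
  imports Defs
begin

text \<open>Let \<open>e\<close> be the vertical unit vector and \<open>h > 0\<close> the minimal gap, so that \<open>a = b + h e\<close>. The
  surface \<open>S1\<close> is not vertical at \<open>a\<close>, hence no point of \<open>S2\<close> near \<open>b\<close> can lie above the translate
  \<open>S1 - h e\<close>: the vertical line through it would meet \<open>S1\<close> at a gap smaller than \<open>h\<close>. So \<open>S2\<close>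
  touches \<open>S1 - h e\<close> from below at \<open>b\<close>. The two surfaces then have a common tangent hyperplane, and
  along each tangent direction \<open>S2\<close> bends upwards at most as much as \<open>S1\<close> does. Summing over an
  orthonormal basis of the hyperplane compares the mean curvatures with respect to the upward
  normal \<open>\<nu>\<close>: \<open>H1(a) \<le> H2(b)\<close>. For self-shrinkers this reads \<open>\<langle>a, \<nu>\<rangle> \<le> \<langle>b, \<nu>\<rangle>\<close>, that is
  \<open>h \<langle>e, \<nu>\<rangle> \<le> 0\<close>, which is absurd. The translation enters the shrinker equation with a strict sign,
  so a weak inequality at the single point of contact suffices.

  In place of graph functions, \<open>S1\<close> is described near \<open>a\<close> as a level set of a function
  \<open>F\<close> with gradient \<open>G\<close>, and the comparison is the second derivative test for
  \<open>F(\<gamma>(t) + h e)\<close> along curves \<open>\<gamma>\<close> in \<open>S2\<close> (\<open>second_order_along_2jet\<close>), whose hypothesis is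
  supplied by \<open>lower_sheet_in_sublevel\<close>. Mean curvature is expressed through the accelerations of
  curves in the surface (\<open>divergence_unit_normal_field\<close>); the resulting form of the shrinker
  equation, \<open>shrinker_acceleration_sum\<close>, is linear in the normal vector, so that the gradient of
  \<open>F\<close> at \<open>a\<close> can serve as the normal vector of both surfaces.\<close>

section \<open>Linear algebra\<close>

lemma orthonormal_trace:
  fixes L :: "'a::euclidean_space \<Rightarrow> 'a"
  assumes L: "linear L" and fin: "finite C" and orth: "pairwise orthogonal C"
    and unit: "\<And>v. v \<in> C \<Longrightarrow> norm v = 1" and sp: "span C = UNIV"
  shows "(\<Sum>i\<in>Basis. L i \<bullet> i) = (\<Sum>v\<in>C. L v \<bullet> v)"
proof -
  have expand: "(\<Sum>v\<in>C. (x \<bullet> v) *\<^sub>R v) = x" for x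
    using orthonormal_basis_expand[OF orth unit _ fin, of x] sp by (simp add: inner_commute)
  have "(\<Sum>i\<in>Basis. L i \<bullet> i) = (\<Sum>i\<in>Basis. L (\<Sum>v\<in>C. (i \<bullet> v) *\<^sub>R v) \<bullet> i)"
    by (simp add: expand)
  also have "\<dots> = (\<Sum>i\<in>Basis. \<Sum>v\<in>C. (v \<bullet> i) * (L v \<bullet> i))"
    by (simp add: linear_sum[OF L] linear_cmul[OF L] inner_sum_left) (simp add: inner_commute)
  also have "\<dots> = (\<Sum>v\<in>C. \<Sum>i\<in>Basis. (v \<bullet> i) * (L v \<bullet> i))"
    by (rule sum.swap)
  also have "\<dots> = (\<Sum>v\<in>C. L v \<bullet> v)"
    by (subst (2) euclidean_inner) (simp add: mult.commute)
  finally show ?thesis .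
qed

text \<open>All the normal vectors that occur, namely gradients of local equations and unit normals,
  are known only through what they annihilate; this identifies them up to a factor.\<close>

lemma parallel_if_annihilates_complement:
  fixes g x :: "'a::euclidean_space"
  assumes "g \<noteq> 0" and "\<And>v. v \<bullet> g = 0 \<Longrightarrow> v \<bullet> x = 0"
  shows "\<exists>k. x = k *\<^sub>R g"
proof -
  define w where "w = x - ((x \<bullet> g) / (g \<bullet> g)) *\<^sub>R g"
  have wg: "w \<bullet> g = 0" using assms(1) by (simp add: w_def inner_diff_left)
  then have "w \<bullet> x = 0" by (rule assms(2))
  with wg have "w \<bullet> w = 0"
    by (subst (2) w_def) (simp add: inner_diff_right)
  then have "w = 0" by simp
  then show ?thesis by (auto simp: w_def)
qed

lemma orthonormal_family_expand:
  fixes e :: "nat \<Rightarrow> 'a::euclidean_space"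
  assumes dim: "DIM('a) = m"
    and on: "\<forall>i\<in>{1..m}. \<forall>j\<in>{1..m}. e i \<bullet> e j = (if i = j then 1 else 0)"
  shows "x = (\<Sum>i\<in>{1..m}. (x \<bullet> e i) *\<^sub>R e i)"
proof -
  let ?E = "e ` {1..m}"
  have inj: "inj_on e {1..m}"
    using on by (intro inj_onI) (metis zero_neq_one)
  have unit: "norm v = 1" if "v \<in> ?E" for v
    using that on by (auto simp: norm_eq_1)
  have orth: "pairwise orthogonal ?E"
    using on by (auto simp: pairwise_def orthogonal_def)
  have "independent ?E"
    using unit by (intro pairwise_orthogonal_independent orth) force
  moreover have "card ?E = DIM('a)"
    using inj dim by (simp add: card_image)
  ultimately have "UNIV \<subseteq> span ?E"
    by (intro card_ge_dim_independent) (auto simp: dim_UNIV)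
  then have "(\<Sum>v\<in>?E. (x \<bullet> v) *\<^sub>R v) = x"
    by (intro orthonormal_basis_expand[OF orth unit]) auto
  then show ?thesis
    by (simp only: sum.reindex[OF inj] o_def)
qed

section \<open>Calculus\<close>

lemma second_derivative_le_0_at_local_max:
  fixes f f' :: "real \<Rightarrow> real"
  assumes f: "\<forall>\<^sub>F t in nhds 0. (f has_real_derivative f' t) (at t) \<and> f t \<le> f 0"
    and f'': "(f' has_real_derivative c) (at 0)"
  shows "f' 0 = 0" and "c \<le> 0"
proof -
  obtain d where d: "d > 0" and
    df: "\<And>t. \<bar>t\<bar> < d \<Longrightarrow> (f has_real_derivative f' t) (at t)" and
    le: "\<And>t. \<bar>t\<bar> < d \<Longrightarrow> f t \<le> f 0"
    using f by (auto simp: eventually_nhds_metric)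
  show 0: "f' 0 = 0"
    by (rule DERIV_local_max[OF df d]) (use d le in auto)
  show "c \<le> 0"
  proof (rule ccontr)
    assume "\<not> c \<le> 0"
    then obtain r where r: "r > 0" "\<And>t. 0 < t \<Longrightarrow> t < r \<Longrightarrow> f' 0 < f' t"
      using DERIV_pos_inc_right[OF f''] by auto
    define s where "s = min d r / 2"
    have s: "0 < s" "s < d" "s < r" using d r(1) by (auto simp: s_def)
    have "f 0 < f s"
      by (rule DERIV_pos_imp_increasing_open[OF s(1)])
        (use s df r(2) 0 in \<open>force intro!: continuous_at_imp_continuous_on DERIV_isCont df\<close>)+
    with le[of s] s show False by auto
  qed
qed

lemma has_vector_derivative_compose:
  assumes "(f has_vector_derivative f') (at t)" and "(g has_derivative g') (at (f t))"
  shows "((\<lambda>t. g (f t)) has_vector_derivative g' f') (at t)"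
  using vector_derivative_diff_chain_within[of f f' t UNIV g g'] assms
  by (simp add: o_def has_derivative_at_withinI)

lemma smooth_on_differentiable:
  assumes "smooth_on f U" and "x \<in> U"
  shows "f differentiable (at x)"
  using assms Ck_on.simps(2)[of 0 f U] unfolding smooth_on_def by blast

lemma smooth_on_partial_differentiable:
  assumes "smooth_on f U" and "x \<in> U" and "i \<in> Basis"
  shows "(\<lambda>x. frechet_derivative f (at x) i) differentiable (at x)"
  using assms Ck_on.simps(2)[of 1 f U] Ck_on.simps(2)[of 0 "\<lambda>x. frechet_derivative f (at x) i" U]
  unfolding smooth_on_def by (metis One_nat_def)

text \<open>Smoothness is phrased with derivatives along the standard basis; other directions follow by
  linearity, which holds on \<open>U\<close> only, so the expansion is used as a germ at \<open>x\<close>.\<close>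

lemma smooth_on_directional_differentiable:
  assumes "smooth_on f U" and "open U" and "x \<in> U"
  shows "(\<lambda>x. frechet_derivative f (at x) v) differentiable (at x)"
proof -
  have eq: "(\<Sum>i\<in>Basis. (v \<bullet> i) *\<^sub>R frechet_derivative f (at y) i) = frechet_derivative f (at y) v"
    if "y \<in> U" for y
  proof -
    have "linear (frechet_derivative f (at y))"
      using smooth_on_differentiable[OF assms(1) that] by (rule linear_frechet_derivative)
    then show ?thesis
      by (subst (3) euclidean_representation[symmetric]) (simp add: linear_sum linear_cmul)
  qed
  have "(\<lambda>y. \<Sum>i\<in>Basis. (v \<bullet> i) *\<^sub>R frechet_derivative f (at y) i) differentiable (at x)"
    by (intro differentiable_sum differentiable_scaleR ballI differentiable_const
        smooth_on_partial_differentiable[OF assms(1,3)]) auto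
  then obtain D where
    "((\<lambda>y. \<Sum>i\<in>Basis. (v \<bullet> i) *\<^sub>R frechet_derivative f (at y) i) has_derivative D) (at x)"
    by (auto simp: differentiable_def)
  then have "((\<lambda>x. frechet_derivative f (at x) v) has_derivative D) (at x)"
    by (rule has_derivative_transform_within_open[OF _ assms(2,3)]) (simp add: eq)
  then show ?thesis by (auto simp: differentiable_def)
qed

section \<open>Second-order jets of curves in a hypersurface\<close>

text \<open>The initial position, velocity and acceleration of a curve in \<open>S\<close> that is defined on both
  sides of time 0. The regularity is what a second derivative test at time 0 asks for.\<close>

definition curve_2jet :: "'a::real_normed_vector set \<Rightarrow> 'a \<Rightarrow> 'a \<Rightarrow> 'a \<Rightarrow> bool" where
  "curve_2jet S p v c \<longleftrightarrow> (\<exists>\<gamma> \<gamma>'. \<gamma> 0 = p \<and> \<gamma>' 0 = v \<and>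
     (\<forall>\<^sub>F t in nhds (0::real). \<gamma> t \<in> S \<and> (\<gamma> has_vector_derivative \<gamma>' t) (at t)) \<and>
     (\<gamma>' has_vector_derivative c) (at 0))"

text \<open>Tangent vectors are velocities of paths that stay in \<open>S\<close> during the whole unit interval.
  Slowing a curve down by a small factor \<open>q\<close> achieves this, and the span absorbs the factor.\<close>

lemma velocity_in_tangent_space:
  fixes \<gamma> :: "real \<Rightarrow> 'a::euclidean_space"
  assumes S: "\<forall>\<^sub>F s in nhds t. \<gamma> s \<in> S" and d: "(\<gamma> has_vector_derivative v) (at t)"
  shows "v \<in> tangent_space S (\<gamma> t)"
proof -
  obtain r where r: "r > 0" "\<And>s. \<bar>s - t\<bar> < r \<Longrightarrow> \<gamma> s \<in> S"
    using S by (auto simp: eventually_nhds_metric dist_real_def)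
  define q where "q = r / 2"
  have q: "q > 0" "q < r" using r by (auto simp: q_def)
  define \<beta> where "\<beta> = (\<lambda>s. \<gamma> (t + q * s))"
  have "((\<lambda>s. t + q * s) has_vector_derivative q) (at 0)"
    by (auto intro!: derivative_eq_intros simp: has_real_derivative_iff_has_vector_derivative[symmetric])
  then have "(\<beta> has_vector_derivative q *\<^sub>R v) (at 0)"
    using vector_diff_chain_at[of "\<lambda>s. t + q * s" q 0 \<gamma> v] d by (simp add: \<beta>_def o_def)
  then have "(\<beta> has_vector_derivative q *\<^sub>R v) (at 0 within {0..1})"
    by (rule has_vector_derivative_at_within)
  moreover have "path_image \<beta> \<subseteq> S"
  proof -
    have "\<bar>t + q * s - t\<bar> < r" if "0 \<le> s" "s \<le> 1" for s
    proof -
      have "\<bar>t + q * s - t\<bar> = q * s" using q that by (simp add: abs_mult)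
      also have "\<dots> \<le> q" using q that by (intro mult_left_le) auto
      finally show ?thesis using q(2) by (rule le_less_trans)
    qed
    then show ?thesis using r(2) by (auto simp: path_image_def \<beta>_def)
  qed
  moreover have "pathstart \<beta> = \<gamma> t" by (simp add: pathstart_def \<beta>_def)
  ultimately have "q *\<^sub>R v \<in> tangent_space S (\<gamma> t)"
    unfolding tangent_space_def by (intro span_base) blast
  then have "(1 / q) *\<^sub>R (q *\<^sub>R v) \<in> tangent_space S (\<gamma> t)"
    unfolding tangent_space_def by (rule span_mul)
  then show ?thesis using q by simp
qed

lemma tangent_space_mono:
  assumes "S \<subseteq> T" shows "tangent_space S p \<subseteq> tangent_space T p"
  unfolding tangent_space_def by (rule span_mono) (use assms in blast)

lemma unit_normal_orthogonal_2jet: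
  fixes S :: "'a::euclidean_space set"
  assumes "unit_normal S p \<nu>" and "curve_2jet S p v c"
  shows "v \<bullet> \<nu> = 0"
proof -
  obtain \<gamma> \<gamma>' where \<gamma>: "\<gamma> 0 = p" "\<gamma>' 0 = v"
    and ev: "\<forall>\<^sub>F t in nhds (0::real). \<gamma> t \<in> S \<and> (\<gamma> has_vector_derivative \<gamma>' t) (at t)"
    using assms(2) by (auto simp: curve_2jet_def)
  have "\<gamma>' 0 \<in> tangent_space S (\<gamma> 0)"
    by (rule velocity_in_tangent_space)
      (use ev eventually_nhds_x_imp_x[OF ev] in \<open>auto elim: eventually_mono\<close>)
  then show ?thesis
    using assms(1) \<gamma> by (auto simp: unit_normal_def orthogonal_def inner_commute)
qed

text \<open>The second fundamental form: along the curve \<open>\<langle>\<nu>, \<gamma>'\<rangle>\<close> vanishes identically, and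
  differentiating once gives the claim.\<close>

lemma normal_derivative_eq_acceleration:
  fixes S :: "'a::euclidean_space set"
  assumes \<nu>: "unit_normal_field S U \<nu>" and p: "p \<in> U" and jet: "curve_2jet S p v c"
  shows "frechet_derivative \<nu> (at p) v \<bullet> v = - (\<nu> p \<bullet> c)"
proof -
  obtain \<gamma> \<gamma>' where \<gamma>: "\<gamma> 0 = p" "\<gamma>' 0 = v"
    and ev: "\<forall>\<^sub>F t in nhds (0::real). \<gamma> t \<in> S \<and> (\<gamma> has_vector_derivative \<gamma>' t) (at t)"
    and c: "(\<gamma>' has_vector_derivative c) (at 0)"
    using jet by (auto simp: curve_2jet_def)
  have U: "open U" "smooth_on \<nu> U" using \<nu> by (auto simp: unit_normal_field_def)
  have d0: "(\<gamma> has_vector_derivative v) (at 0)"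
    using eventually_nhds_x_imp_x[OF ev] \<gamma> by auto
  have "\<forall>\<^sub>F t in at 0. \<gamma> t \<in> U"
    using has_vector_derivative_continuous[OF d0] U(1) p \<gamma>(1)
    by (auto simp: continuous_at intro: topological_tendstoD)
  then have evU: "\<forall>\<^sub>F t in nhds 0. \<gamma> t \<in> U"
    using p \<gamma>(1) by (auto simp: eventually_at_filter elim: eventually_mono)
  have zero: "\<forall>\<^sub>F t in nhds 0. \<nu> (\<gamma> t) \<bullet> \<gamma>' t = 0"
  proof -
    have "\<forall>\<^sub>F t in nhds 0. \<forall>\<^sub>F s in nhds t. \<gamma> s \<in> S \<and> (\<gamma> has_vector_derivative \<gamma>' s) (at s)"
      using ev by (simp add: eventually_eventually)
    with evU show ?thesis
    proof eventually_elim
      case (elim t)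
      have "\<gamma>' t \<in> tangent_space S (\<gamma> t)"
        by (rule velocity_in_tangent_space)
          (use elim(2) eventually_nhds_x_imp_x[OF elim(2)] in \<open>auto elim: eventually_mono\<close>)
      moreover have "\<gamma> t \<in> S \<inter> U" using elim(1) eventually_nhds_x_imp_x[OF elim(2)] by auto
      ultimately show ?case
        using \<nu> by (auto simp: unit_normal_field_def unit_normal_def orthogonal_def)
    qed
  qed
  have D: "(\<nu> has_derivative frechet_derivative \<nu> (at p)) (at p)"
    using smooth_on_differentiable[OF U(2) p] by (simp add: frechet_derivative_works)
  have "((\<lambda>t. \<nu> (\<gamma> t)) has_vector_derivative frechet_derivative \<nu> (at p) v) (at 0)"
    using has_vector_derivative_compose[OF d0] D \<gamma>(1) by blast
  then have "((\<lambda>t. \<nu> (\<gamma> t) \<bullet> \<gamma>' t) has_derivative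
      (\<lambda>t. \<nu> (\<gamma> 0) \<bullet> (t *\<^sub>R c) + (t *\<^sub>R frechet_derivative \<nu> (at p) v) \<bullet> \<gamma>' 0)) (at 0)"
    using c unfolding has_vector_derivative_def by (rule has_derivative_inner)
  moreover have "((\<lambda>t. \<nu> (\<gamma> t) \<bullet> \<gamma>' t) has_derivative (\<lambda>t. 0)) (at 0)"
  proof (rule has_derivative_transform_eventually[OF has_derivative_const[of 0]])
    show "\<forall>\<^sub>F t in at 0. 0 = \<nu> (\<gamma> t) \<bullet> \<gamma>' t"
      using zero by (auto simp: eventually_at_filter elim: eventually_mono)
    show "0 = \<nu> (\<gamma> 0) \<bullet> \<gamma>' 0" using eventually_nhds_x_imp_x[OF zero] by simp
  qed auto
  ultimately have "(\<lambda>t. \<nu> (\<gamma> 0) \<bullet> (t *\<^sub>R c) + (t *\<^sub>R frechet_derivative \<nu> (at p) v) \<bullet> \<gamma>' 0) = (\<lambda>t. 0)"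
    by (rule has_derivative_unique)
  from fun_cong[OF this, of 1] show ?thesis using \<gamma> by simp
qed

text \<open>The divergence is a trace, which may be computed in the orthonormal basis formed by \<open>\<nu>\<close> and \<open>B\<close>.
  The normal direction contributes nothing because \<open>\<nu>\<close> has constant length on an open set; the
  tangential directions give the accelerations.\<close>

lemma divergence_unit_normal_field:
  fixes S :: "'a::euclidean_space set"
  assumes \<nu>: "unit_normal_field S U \<nu>" and p: "p \<in> S \<inter> U" and g: "g \<noteq> 0"
    and B: "pairwise orthogonal B" "\<And>v. v \<in> B \<Longrightarrow> norm v = 1" "span B = {v. v \<bullet> g = 0}" "finite B"
    and jets: "\<And>v. v \<bullet> g = 0 \<Longrightarrow> \<exists>c. curve_2jet S p v c"
    and c: "\<And>v. v \<in> B \<Longrightarrow> curve_2jet S p v (c v)"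
  shows "divergence \<nu> p = - (\<Sum>v\<in>B. \<nu> p \<bullet> c v)" and "\<exists>k. k \<noteq> 0 \<and> \<nu> p = k *\<^sub>R g"
proof -
  let ?D = "frechet_derivative \<nu> (at p)"
  have U: "open U" "smooth_on \<nu> U" "\<And>x. x \<in> U \<Longrightarrow> norm (\<nu> x) = 1" "unit_normal S p (\<nu> p)"
    using \<nu> p by (auto simp: unit_normal_field_def)
  have "\<exists>k. \<nu> p = k *\<^sub>R g"
    using parallel_if_annihilates_complement[OF g] jets unit_normal_orthogonal_2jet[OF U(4)] by blast
  then show k: "\<exists>k. k \<noteq> 0 \<and> \<nu> p = k *\<^sub>R g"
    using U(3)[of p] p by (metis IntD2 norm_zero scaleR_zero_left zero_neq_one)
  then obtain k where k: "k \<noteq> 0" "\<nu> p = k *\<^sub>R g" by auto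
  have D: "(\<nu> has_derivative ?D) (at p)"
    using smooth_on_differentiable[OF U(2)] p by (simp add: frechet_derivative_works)
  have "((\<lambda>x. \<nu> x \<bullet> \<nu> x) has_derivative (\<lambda>w. \<nu> p \<bullet> ?D w + ?D w \<bullet> \<nu> p)) (at p)"
    by (rule has_derivative_inner[OF D D])
  moreover have "((\<lambda>x. \<nu> x \<bullet> \<nu> x) has_derivative (\<lambda>w. 0)) (at p)"
    by (rule has_derivative_transform_within_open[OF has_derivative_const[of 1] U(1)])
      (use p U(3) in \<open>auto simp: norm_eq_1\<close>)
  ultimately have "(\<lambda>w. \<nu> p \<bullet> ?D w + ?D w \<bullet> \<nu> p) = (\<lambda>w. 0)"
    by (rule has_derivative_unique)
  from fun_cong[OF this, of "\<nu> p"] have normal: "?D (\<nu> p) \<bullet> \<nu> p = 0"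
    by (simp add: inner_commute)
  have perp: "v \<bullet> \<nu> p = 0" if "v \<in> B" for v
    using B(3) span_base[OF that] k by auto
  have notin: "\<nu> p \<notin> B" using perp U(3)[of p] p by force
  have "UNIV \<subseteq> span (insert (\<nu> p) B)"
  proof
    fix x
    have "(x - (x \<bullet> \<nu> p) *\<^sub>R \<nu> p) \<bullet> \<nu> p = 0"
      using U(3)[of p] p by (simp add: inner_diff_left norm_eq_1)
    then have "x - (x \<bullet> \<nu> p) *\<^sub>R \<nu> p \<in> span B"
      using k B(3) by simp
    then show "x \<in> span (insert (\<nu> p) B)"
      by (auto simp: span_breakdown_eq)
  qed
  then have "(\<Sum>i\<in>Basis. ?D i \<bullet> i) = (\<Sum>v\<in>insert (\<nu> p) B. ?D v \<bullet> v)"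
    by (intro orthonormal_trace has_derivative_linear[OF D])
      (use B p U(3) perp in \<open>auto simp: pairwise_insert orthogonal_def inner_commute\<close>)
  also have "\<dots> = (\<Sum>v\<in>B. ?D v \<bullet> v)"
    using notin B(4) normal by simp
  also have "\<dots> = (\<Sum>v\<in>B. - (\<nu> p \<bullet> c v))"
    by (intro sum.cong refl normal_derivative_eq_acceleration[OF \<nu>]) (use p c in auto)
  finally show "divergence \<nu> p = - (\<Sum>v\<in>B. \<nu> p \<bullet> c v)"
    by (simp add: divergence_def sum_negf)
qed

text \<open>The shrinker equation for an arbitrary normal vector \<open>g\<close> in place of \<open>\<nu>\<close>. Both sides of
  \<open>H = \<langle>x, \<nu>\<rangle> / 2\<close> are linear in \<open>\<nu>\<close> once \<open>H\<close> is written with accelerations. A normal field of a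
  larger hypersurface is one of \<open>S\<close>, since \<open>S\<close> has fewer tangent vectors.\<close>

lemma shrinker_acceleration_sum:
  fixes S :: "'a::euclidean_space set"
  assumes part: "part_of_self_shrinker S" and p: "p \<in> S" and g: "g \<noteq> 0"
    and B: "pairwise orthogonal B" "\<And>v. v \<in> B \<Longrightarrow> norm v = 1" "span B = {v. v \<bullet> g = 0}" "finite B"
    and jets: "\<And>v. v \<bullet> g = 0 \<Longrightarrow> \<exists>c. curve_2jet S p v c"
    and c: "\<And>v. v \<in> B \<Longrightarrow> curve_2jet S p v (c v)"
  shows "(\<Sum>v\<in>B. g \<bullet> c v) = - (p \<bullet> g) / 2"
proof -
  obtain T where T: "self_shrinker T" "S \<subseteq> T"
    using part by (auto simp: part_of_self_shrinker_def)
  then obtain U \<nu> where U: "p \<in> U" "unit_normal_field T U \<nu>"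
    and eq: "\<forall>x\<in>T \<inter> U. divergence \<nu> x = (x \<bullet> \<nu> x) / 2"
    using p unfolding self_shrinker_def by (metis subsetD)
  have \<nu>: "unit_normal_field S U \<nu>"
    using U(2) T(2) tangent_space_mono[OF T(2)]
    unfolding unit_normal_field_def unit_normal_def by blast
  have pU: "p \<in> S \<inter> U" using p U by simp
  note div = divergence_unit_normal_field[OF \<nu> pU g B jets c]
  obtain k where k: "k \<noteq> 0" "\<nu> p = k *\<^sub>R g" using div(2) by blast
  have "divergence \<nu> p = (p \<bullet> \<nu> p) / 2" using eq pU T(2) by auto
  with div(1) have "k * (\<Sum>v\<in>B. g \<bullet> c v) = k * (- (p \<bullet> g) / 2)"
    by (simp add: k(2) sum_distrib_left)
  then show ?thesis using k(1) by (metis mult_left_cancel)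
qed

section \<open>Interior points of hypersurfaces\<close>

text \<open>In a chart \<open>\<phi>\<close> that flattens \<open>S\<close> to the hyperplane orthogonal to \<open>u\<close>, the function
  \<open>\<langle>u, \<phi>(x)\<rangle>\<close> is a local equation. Every vector \<open>v\<close> orthogonal to its gradient at \<open>p\<close> is the velocity
  of a curve in \<open>S\<close>, the image under the inverse chart of the straight line with direction \<open>D\<phi>(p) v\<close>.\<close>

lemma hs_interior_local_equation:
  fixes S :: "'a::euclidean_space set"
  assumes "p \<in> hs_interior S"
  obtains U F G where "open U" "p \<in> U" "\<And>x. x \<in> U \<Longrightarrow> x \<in> S \<longleftrightarrow> F x = 0"
    "\<And>x. x \<in> U \<Longrightarrow> (F has_derivative (\<lambda>v. v \<bullet> G x)) (at x)"
    "G differentiable (at p)" "G p \<noteq> 0"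
    "\<And>v. v \<bullet> G p = 0 \<Longrightarrow> \<exists>c. curve_2jet S p v c"
proof -
  obtain u :: 'a and U V :: "'a set" and \<phi> \<psi> :: "'a \<Rightarrow> 'a" where u: "u \<noteq> 0" and UV: "open U" "open V" "p \<in> U"
    and hom: "homeomorphism U V \<phi> \<psi>" and sm: "smooth_on \<phi> U" "smooth_on \<psi> V"
    and \<phi>p: "\<phi> p = 0" and im: "\<phi> ` (S \<inter> U) = {y. u \<bullet> y = 0} \<inter> V"
    using assms unfolding hs_interior_def slice_chart_at_def by blast
  have inv: "\<And>x. x \<in> U \<Longrightarrow> \<psi> (\<phi> x) = x" "\<And>y. y \<in> V \<Longrightarrow> \<phi> (\<psi> y) = y"
    and maps: "\<And>x. x \<in> U \<Longrightarrow> \<phi> x \<in> V" "\<And>y. y \<in> V \<Longrightarrow> \<psi> y \<in> U"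
    using hom by (simp_all add: homeomorphism_def) blast+
  have SU: "x \<in> S \<longleftrightarrow> u \<bullet> \<phi> x = 0" if "x \<in> U" for x
  proof
    assume "u \<bullet> \<phi> x = 0"
    then have "\<phi> x \<in> \<phi> ` (S \<inter> U)" using im maps(1)[OF that] by auto
    then show "x \<in> S" using inv(1) that by (metis IntD1 IntD2 imageE)
  qed (use im that in auto)
  let ?D\<phi> = "\<lambda>x. frechet_derivative \<phi> (at x)" and ?D\<psi> = "\<lambda>y. frechet_derivative \<psi> (at y)"
  have D\<phi>: "(\<phi> has_derivative ?D\<phi> x) (at x)" if "x \<in> U" for x
    using smooth_on_differentiable[OF sm(1) that] by (simp add: frechet_derivative_works)
  have D\<psi>: "(\<psi> has_derivative ?D\<psi> y) (at y)" if "y \<in> V" for y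
    using smooth_on_differentiable[OF sm(2) that] by (simp add: frechet_derivative_works)
  have V0: "0 \<in> V" using maps(1)[OF UV(3)] \<phi>p by simp
  have \<psi>0: "\<psi> 0 = p" using inv(1)[OF UV(3)] \<phi>p by simp
  have "((\<lambda>x. \<psi> (\<phi> x)) has_derivative (\<lambda>v. ?D\<psi> 0 (?D\<phi> p v))) (at p)"
    using has_derivative_compose[OF D\<phi>[OF UV(3)], of \<psi> "?D\<psi> 0"] D\<psi>[OF V0] \<phi>p by simp
  moreover have "((\<lambda>x. \<psi> (\<phi> x)) has_derivative (\<lambda>v. v)) (at p)"
    by (rule has_derivative_transform_within_open[OF has_derivative_ident UV(1,3)]) (simp add: inv)
  ultimately have "(\<lambda>v. ?D\<psi> 0 (?D\<phi> p v)) = (\<lambda>v. v)" by (rule has_derivative_unique)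
  then have \<psi>\<phi>: "?D\<psi> 0 (?D\<phi> p v) = v" for v by (rule fun_cong)
  have "((\<lambda>x. \<phi> (\<psi> x)) has_derivative (\<lambda>v. ?D\<phi> p (?D\<psi> 0 v))) (at 0)"
    using has_derivative_compose[OF D\<psi>[OF V0], of \<phi> "?D\<phi> p"] D\<phi>[OF UV(3)] \<psi>0 by simp
  moreover have "((\<lambda>x. \<phi> (\<psi> x)) has_derivative (\<lambda>v. v)) (at 0)"
    by (rule has_derivative_transform_within_open[OF has_derivative_ident UV(2) V0]) (simp add: inv)
  ultimately have "(\<lambda>v. ?D\<phi> p (?D\<psi> 0 v)) = (\<lambda>v. v)" by (rule has_derivative_unique)
  then have \<phi>\<psi>: "?D\<phi> p (?D\<psi> 0 v) = v" for v by (rule fun_cong)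
  define F where "F = (\<lambda>x. u \<bullet> \<phi> x)"
  define G where "G = (\<lambda>x. \<Sum>i\<in>Basis. (u \<bullet> ?D\<phi> x i) *\<^sub>R i)"
  have G: "v \<bullet> G x = u \<bullet> ?D\<phi> x v" if "x \<in> U" for x v
  proof -
    have "linear (?D\<phi> x)" using D\<phi>[OF that] by (rule has_derivative_linear)
    then have "?D\<phi> x v = (\<Sum>i\<in>Basis. (v \<bullet> i) *\<^sub>R ?D\<phi> x i)"
      by (subst euclidean_representation[symmetric, of v]) (simp add: linear_sum linear_cmul)
    then show ?thesis by (simp add: G_def inner_sum_right mult.commute)
  qed
  show thesis
  proof (rule that[OF UV(1,3)])
    show "x \<in> S \<longleftrightarrow> F x = 0" if "x \<in> U" for x using SU[OF that] by (simp add: F_def)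
    show "(F has_derivative (\<lambda>v. v \<bullet> G x)) (at x)" if "x \<in> U" for x
      unfolding F_def G[OF that] by (intro has_derivative_inner_right D\<phi> that)
    show "G differentiable (at p)"
      unfolding G_def
      by (intro differentiable_sum ballI differentiable_scaleR differentiable_const
          differentiable_inner smooth_on_partial_differentiable[OF sm(1) UV(3)]) auto
    show "G p \<noteq> 0"
      using G[OF UV(3), of "?D\<psi> 0 u"] u \<phi>\<psi>[of u] by auto
    fix v assume v: "v \<bullet> G p = 0"
    define \<eta> where "\<eta> = ?D\<phi> p v"
    have \<eta>: "u \<bullet> \<eta> = 0" using v G[OF UV(3)] by (simp add: \<eta>_def)
    have line: "((\<lambda>t. t *\<^sub>R \<eta>) has_vector_derivative \<eta>) (at t)" for t :: real
      by (auto intro!: derivative_eq_intros)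
    have "((\<lambda>t::real. t *\<^sub>R \<eta>) \<longlongrightarrow> 0 *\<^sub>R \<eta>) (nhds 0)"
      by (intro tendsto_intros filterlim_ident)
    then have evV: "\<forall>\<^sub>F t in nhds (0::real). t *\<^sub>R \<eta> \<in> V"
      using UV(2) V0 by (auto intro: topological_tendstoD)
    obtain D where D: "((\<lambda>y. ?D\<psi> y \<eta>) has_derivative D) (at 0)"
      using smooth_on_directional_differentiable[OF sm(2) UV(2) V0] by (auto simp: differentiable_def)
    have "curve_2jet S p v (D \<eta>)"
      unfolding curve_2jet_def
    proof (intro exI conjI)
      show "\<psi> (0 *\<^sub>R \<eta>) = p" by (simp add: \<psi>0)
      show "?D\<psi> (0 *\<^sub>R \<eta>) \<eta> = v" using \<psi>\<phi> by (simp add: \<eta>_def)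
      show "\<forall>\<^sub>F t in nhds (0::real). \<psi> (t *\<^sub>R \<eta>) \<in> S \<and>
          ((\<lambda>t. \<psi> (t *\<^sub>R \<eta>)) has_vector_derivative ?D\<psi> (t *\<^sub>R \<eta>) \<eta>) (at t)"
        using evV
      proof eventually_elim
        case (elim t)
        have "((\<lambda>t. \<psi> (t *\<^sub>R \<eta>)) has_vector_derivative ?D\<psi> (t *\<^sub>R \<eta>) \<eta>) (at t)"
          by (rule has_vector_derivative_compose[OF line D\<psi>[OF elim]])
        moreover have "\<psi> (t *\<^sub>R \<eta>) \<in> S"
          using SU[OF maps(2)[OF elim]] inv(2)[OF elim] \<eta> by simp
        ultimately show ?case by simp
      qed
      show "((\<lambda>t::real. ?D\<psi> (t *\<^sub>R \<eta>) \<eta>) has_vector_derivative D \<eta>) (at 0)"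
        by (rule has_vector_derivative_compose[OF line]) (simp add: D)
    qed
    then show "\<exists>c. curve_2jet S p v c" by blast
  qed
qed

text \<open>The first and second derivatives of \<open>F(\<gamma>(t) + d)\<close> at its local maximum \<open>t = 0\<close>. The term
  with \<open>G'\<close>, the Hessian of \<open>F\<close>, depends on the velocity alone, so it cancels when the accelerations
  of two curves with the same velocity are compared.\<close>

lemma second_order_along_2jet:
  fixes F :: "'a::euclidean_space \<Rightarrow> real"
  assumes U: "open U" "p + d \<in> U"
    and F: "\<And>x. x \<in> U \<Longrightarrow> (F has_derivative (\<lambda>v. v \<bullet> G x)) (at x)"
    and G: "(G has_derivative G') (at (p + d))"
    and jet: "curve_2jet S p v c"
    and le: "\<forall>\<^sub>F x in nhds p. x \<in> S \<longrightarrow> F (x + d) \<le> F (p + d)"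
  shows "v \<bullet> G (p + d) = 0" and "c \<bullet> G (p + d) + v \<bullet> G' v \<le> 0"
proof -
  obtain \<gamma> \<gamma>' where \<gamma>: "\<gamma> 0 = p" "\<gamma>' 0 = v"
    and ev: "\<forall>\<^sub>F t in nhds (0::real). \<gamma> t \<in> S \<and> (\<gamma> has_vector_derivative \<gamma>' t) (at t)"
    and c: "(\<gamma>' has_vector_derivative c) (at 0)"
    using jet by (auto simp: curve_2jet_def)
  have d0: "(\<gamma> has_vector_derivative v) (at 0)"
    using eventually_nhds_x_imp_x[OF ev] \<gamma> by auto
  have lim: "(\<gamma> \<longlongrightarrow> p) (nhds 0)"
    using has_vector_derivative_continuous[OF d0] tendsto_at_iff_tendsto_nhds[of \<gamma> 0] \<gamma>(1)
    by (simp add: continuous_at)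
  have "((\<lambda>t. \<gamma> t + d) \<longlongrightarrow> p + d) (nhds 0)"
    by (intro tendsto_intros lim)
  then have evU: "\<forall>\<^sub>F t in nhds 0. \<gamma> t + d \<in> U"
    using U by (auto intro: topological_tendstoD)
  have evle: "\<forall>\<^sub>F t in nhds 0. \<gamma> t \<in> S \<longrightarrow> F (\<gamma> t + d) \<le> F (p + d)"
    using le lim by (rule eventually_compose_filterlim)
  have 1: "\<forall>\<^sub>F t in nhds 0.
      ((\<lambda>t. F (\<gamma> t + d)) has_real_derivative \<gamma>' t \<bullet> G (\<gamma> t + d)) (at t) \<and> F (\<gamma> t + d) \<le> F (\<gamma> 0 + d)"
    using ev evU evle
  proof eventually_elim
    case (elim t)
    have "((\<lambda>t. \<gamma> t + d) has_vector_derivative \<gamma>' t) (at t)"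
      using elim(1) by (auto intro!: derivative_eq_intros)
    then have "((\<lambda>t. F (\<gamma> t + d)) has_vector_derivative \<gamma>' t \<bullet> G (\<gamma> t + d)) (at t)"
      by (rule has_vector_derivative_compose) (rule F[OF elim(2)])
    then show ?case
      using elim \<gamma> by (simp add: has_real_derivative_iff_has_vector_derivative)
  qed
  have "((\<lambda>t. \<gamma> t + d) has_vector_derivative v) (at 0)"
    using d0 by (auto intro!: derivative_eq_intros)
  then have "((\<lambda>t. G (\<gamma> t + d)) has_vector_derivative G' v) (at 0)"
    by (rule has_vector_derivative_compose) (simp add: G \<gamma>(1))
  then have "((\<lambda>t. \<gamma>' t \<bullet> G (\<gamma> t + d)) has_derivative
      (\<lambda>t. \<gamma>' 0 \<bullet> (t *\<^sub>R G' v) + (t *\<^sub>R c) \<bullet> G (\<gamma> 0 + d))) (at 0)"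
    using c unfolding has_vector_derivative_def by (intro has_derivative_inner)
  then have 2: "((\<lambda>t. \<gamma>' t \<bullet> G (\<gamma> t + d)) has_real_derivative c \<bullet> G (p + d) + v \<bullet> G' v) (at 0)"
    unfolding has_field_derivative_def using \<gamma>
    by (elim has_derivative_eq_rhs) (auto simp: algebra_simps)
  from second_derivative_le_0_at_local_max[OF 1 2]
  show "v \<bullet> G (p + d) = 0" "c \<bullet> G (p + d) + v \<bullet> G' v \<le> 0" using \<gamma> by auto
qed

lemma second_order_along_2jet_in_level_set:
  fixes F :: "'a::euclidean_space \<Rightarrow> real"
  assumes U: "open U" "p \<in> U"
    and F: "\<And>x. x \<in> U \<Longrightarrow> (F has_derivative (\<lambda>v. v \<bullet> G x)) (at x)"
    and G: "(G has_derivative G') (at p)"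
    and jet: "curve_2jet S p v c"
    and level: "\<forall>\<^sub>F x in nhds p. x \<in> S \<longrightarrow> F x = F p"
  shows "c \<bullet> G p + v \<bullet> G' v = 0"
proof (rule antisym)
  have le: "\<forall>\<^sub>F x in nhds p. x \<in> S \<longrightarrow> F x \<le> F p" "\<forall>\<^sub>F x in nhds p. x \<in> S \<longrightarrow> - F x \<le> - F p"
    using level by (auto elim: eventually_mono)
  show "c \<bullet> G p + v \<bullet> G' v \<le> 0"
    using second_order_along_2jet(2)[of U p 0 F G G' S v c] U F G jet le(1) by simp
  have "((\<lambda>x. - G x) has_derivative (\<lambda>w. - G' w)) (at p)"
    using G by (rule has_derivative_minus)
  moreover have "((\<lambda>x. - F x) has_derivative (\<lambda>w. w \<bullet> - G x)) (at x)" if "x \<in> U" for x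
    using has_derivative_minus[OF F[OF that]] by simp
  ultimately have "c \<bullet> - G p + v \<bullet> - G' v \<le> 0"
    using second_order_along_2jet(2)[of U p 0 "\<lambda>x. - F x" "\<lambda>x. - G x" "\<lambda>w. - G' w" S v c] U jet le(2)
    by simp
  then show "0 \<le> c \<bullet> G p + v \<bullet> G' v" by simp
qed

section \<open>Contact from below\<close>

lemma vertical_gap_le:
  assumes "b \<in> S2" and "strictly_below n e b x"
  shows "vertical_gap n e S2 x \<le> ereal (x \<bullet> e (n + 1) - b \<bullet> e (n + 1))"
proof -
  have mem: "x \<bullet> e (n + 1) - b \<bullet> e (n + 1) \<in> gaps_below n e S2 x"
    using assms by (auto simp: gaps_below_def)
  have "bdd_below (gaps_below n e S2 x)"
    by (rule bdd_belowI[of _ 0]) (auto simp: gaps_below_def strictly_below_def)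
  from cInf_lower[OF mem this] mem show ?thesis
    by (auto simp: vertical_gap_def)
qed

text \<open>If \<open>F\<close> were positive at \<open>y + h e\<close> for some \<open>y\<close> in \<open>S2\<close> near \<open>b\<close>, then moving down by a small
  amount \<open>s\<close> would make \<open>F\<close> negative, as \<open>F\<close> increases upwards at \<open>a\<close>. In between lies a point of
  \<open>S1\<close> straight above \<open>y\<close>, at a gap below \<open>h\<close>, against the minimality of the gap at \<open>a\<close>.\<close>

lemma lower_sheet_in_sublevel:
  fixes F :: "'a::euclidean_space \<Rightarrow> real" and e :: "nat \<Rightarrow> 'a"
  assumes on: "\<forall>i\<in>{1..n+1}. \<forall>j\<in>{1..n+1}. e i \<bullet> e j = (if i = j then 1 else 0)"
    and U: "open U" "a \<in> U"
    and level: "\<And>x. x \<in> U \<Longrightarrow> x \<in> S1 \<longleftrightarrow> F x = 0" and a: "a \<in> S1"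
    and F: "\<And>x. x \<in> U \<Longrightarrow> (F has_derivative (\<lambda>v. v \<bullet> G x)) (at x)"
    and up: "e (n + 1) \<bullet> G a > 0"
    and h: "h > 0" "a = b + h *\<^sub>R e (n + 1)"
    and gap: "vertical_gap n e S2 a = ereal h"
    and min: "\<forall>\<^sub>F x in at a within S1. vertical_gap n e S2 a \<le> vertical_gap n e S2 x"
  shows "\<forall>\<^sub>F y in nhds b. y \<in> S2 \<longrightarrow> F (y + h *\<^sub>R e (n + 1)) \<le> 0"
proof -
  let ?e = "e (n + 1)"
  have e: "norm ?e = 1" using on by (simp add: norm_eq_1)
  have "\<forall>\<^sub>F x in nhds a. x \<in> U \<and> (x \<in> S1 \<longrightarrow> ereal h \<le> vertical_gap n e S2 x)"
  proof (rule eventually_conj)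
    show "\<forall>\<^sub>F x in nhds a. x \<in> U" using U by (rule eventually_nhds_in_open)
    show "\<forall>\<^sub>F x in nhds a. x \<in> S1 \<longrightarrow> ereal h \<le> vertical_gap n e S2 x"
      using min unfolding eventually_at_filter by eventually_elim (use gap in auto)
  qed
  then obtain r where r: "r > 0" "\<And>x. dist x a < r \<Longrightarrow> x \<in> U"
    "\<And>x. dist x a < r \<Longrightarrow> x \<in> S1 \<Longrightarrow> ereal h \<le> vertical_gap n e S2 x"
    unfolding eventually_nhds_metric by blast
  have "((\<lambda>t. a + t *\<^sub>R ?e) has_vector_derivative ?e) (at 0)"
    by (auto intro!: derivative_eq_intros)
  then have "((\<lambda>t. F (a + t *\<^sub>R ?e)) has_real_derivative ?e \<bullet> G a) (at 0)"
    unfolding has_real_derivative_iff_has_vector_derivative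
    by (rule has_vector_derivative_compose) (simp add: F[OF U(2)])
  from DERIV_pos_inc_left[OF this up] obtain q where
    q: "q > 0" "\<And>t. 0 < t \<Longrightarrow> t < q \<Longrightarrow> F (a - t *\<^sub>R ?e) < F a"
    by auto
  \<comment> \<open>\<open>s < q\<close> makes \<open>F\<close> negative below \<open>a\<close>, \<open>s \<le> r / 2\<close> keeps the points in the neighbourhood where
    the gap is minimal, and \<open>s < h\<close> keeps the point found on \<open>S1\<close> above \<open>y\<close>.\<close>
  define s where "s = Min {q, r, h} / 2"
  have s: "0 < s" "s < q" "s < h" "s \<le> r / 2"
    using q(1) r(1) h(1) by (auto simp: s_def min_def)
  have cont: "continuous_on U F"
    using F by (intro continuous_at_imp_continuous_on ballI has_derivative_continuous) auto
  have Fneg: "F (a - s *\<^sub>R ?e) < 0" using q(2)[of s] s level[OF U(2)] a by auto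
  have aU: "a - s *\<^sub>R ?e \<in> U" using r(1) s e by (intro r(2)) (simp add: dist_norm)
  have "isCont F (a - s *\<^sub>R ?e)" using cont U(1) aU by (simp add: continuous_on_eq_continuous_at)
  then have "((\<lambda>y. F (y + h *\<^sub>R ?e - s *\<^sub>R ?e)) \<longlongrightarrow> F (a - s *\<^sub>R ?e)) (nhds b)"
    unfolding h(2) by (intro isCont_tendsto_compose[of _ F] tendsto_intros filterlim_ident)
  then have "\<forall>\<^sub>F y in nhds b. F (y + h *\<^sub>R ?e - s *\<^sub>R ?e) < 0"
    using Fneg by (rule order_tendstoD(2))
  moreover have "\<forall>\<^sub>F y in nhds b. dist y b < r / 2"
    using r(1) by (auto simp: eventually_nhds_metric intro!: exI[of _ "r/2"])
  ultimately show ?thesis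
  proof eventually_elim
    case (elim y)
    show ?case
    proof (intro impI, rule ccontr)
      let ?z = "y + h *\<^sub>R ?e"
      assume y: "y \<in> S2" and pos: "\<not> F ?z \<le> 0"
      have near: "dist (?z - t *\<^sub>R ?e) a < r" if "0 \<le> t" "t \<le> s" for t
      proof -
        have "dist (?z - t *\<^sub>R ?e) a = norm ((y - b) - t *\<^sub>R ?e)"
          by (simp add: dist_norm h(2) algebra_simps)
        also have "\<dots> \<le> dist y b + t"
          using norm_triangle_ineq4[of "y - b" "t *\<^sub>R ?e"] that e by (simp add: dist_norm)
        finally show ?thesis using elim(2) that s by linarith
      qed
      have "continuous_on {0..s} (\<lambda>t. F (?z - t *\<^sub>R ?e))"
        by (intro continuous_on_compose2[OF cont] continuous_intros) (use near r(2) in auto)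
      then obtain t where t: "0 \<le> t" "t \<le> s" "F (?z - t *\<^sub>R ?e) = 0"
        using IVT2'[of "\<lambda>t. F (?z - t *\<^sub>R ?e)" s 0 0] elim(1) pos s(1) by (force simp: algebra_simps)
      let ?x = "?z - t *\<^sub>R ?e"
      have "t \<noteq> 0" using t pos by auto
      have x: "?x \<in> S1" using level r(2)[OF near[OF t(1,2)]] t(3) by blast
      have xe: "?x \<bullet> ?e - y \<bullet> ?e = h - t"
        using e by (simp add: inner_diff_left inner_add_left norm_eq_1)
      have "strictly_below n e y ?x"
        unfolding strictly_below_def using xe t s on
        by (auto simp: inner_diff_left inner_add_left)
      from vertical_gap_le[OF y this] r(3)[OF near[OF t(1,2)] x]
      have "ereal h \<le> ereal (h - t)" unfolding xe by (rule order_trans[rotated])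
      with t \<open>t \<noteq> 0\<close> show False by simp
    qed
  qed
qed

theorem proposition6:
  fixes n :: nat
    and e :: "nat \<Rightarrow> 'a::euclidean_space"
    and S1 S2 :: "'a set"
    and a b \<nu>a :: 'a
  assumes "DIM('a) = n + 1"
    and "\<forall>i\<in>{1..n+1}. \<forall>j\<in>{1..n+1}. e i \<bullet> e j = (if i = j then 1 else 0)"
    and "complete_hypersurface S1" and "complete_hypersurface S2"
    and "S1 \<inter> S2 = {}"
    and "a \<in> S1" and "b \<in> S2"
    and "vertical_gap n e S2 a < \<infinity>"
    and "\<forall>\<^sub>F x in at a within S1. vertical_gap n e S2 a \<le> vertical_gap n e S2 x"
    and "strictly_below n e b a"
    and "vertical_gap n e S2 a = ereal (a \<bullet> e (n + 1) - b \<bullet> e (n + 1))"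
    and "a \<notin> hs_boundary S1" and "b \<notin> hs_boundary S2"
    and "unit_normal S1 a \<nu>a" and "\<nu>a \<bullet> e (n + 1) \<noteq> 0"
  shows "\<not> part_of_self_shrinker S1 \<or> \<not> part_of_self_shrinker S2"
proof (rule ccontr)
  assume "\<not> ?thesis"
  then have part: "part_of_self_shrinker S1" "part_of_self_shrinker S2" by auto
  let ?e = "e (n + 1)"
  define h where "h = a \<bullet> ?e - b \<bullet> ?e"
  have h: "h > 0" using assms(10) by (simp add: h_def strictly_below_def)
  have "a - b = (\<Sum>i\<in>{1..n+1}. ((a - b) \<bullet> e i) *\<^sub>R e i)"
    by (rule orthonormal_family_expand[OF assms(1,2)])
  also have "\<dots> = (\<Sum>i\<in>{n+1}. ((a - b) \<bullet> e i) *\<^sub>R e i)"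
    by (rule sum.mono_neutral_right)
      (use assms(10) in \<open>auto simp: strictly_below_def inner_diff_left le_Suc_eq\<close>)
  finally have ab: "a = b + h *\<^sub>R ?e"
    by (simp add: h_def inner_diff_left algebra_simps)
  have "a \<in> hs_interior S1" "b \<in> hs_interior S2"
    using assms(3,4,6,7,12,13) by (auto simp: complete_hypersurface_def hypersurface_def)
  then obtain U F0 G0 U2 F2 G2 where
    U: "open U" "a \<in> U" and F0: "\<And>x. x \<in> U \<Longrightarrow> x \<in> S1 \<longleftrightarrow> F0 x = 0"
      "\<And>x. x \<in> U \<Longrightarrow> (F0 has_derivative (\<lambda>v. v \<bullet> G0 x)) (at x)"
      "G0 differentiable (at a)" "G0 a \<noteq> 0"
      "\<And>v. v \<bullet> G0 a = 0 \<Longrightarrow> \<exists>c. curve_2jet S1 a v c"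
    and G2: "G2 b \<noteq> 0" "\<And>v. v \<bullet> (G2 b :: 'a) = 0 \<Longrightarrow> \<exists>c. curve_2jet S2 b v c"
    by (elim hs_interior_local_equation) blast
  have "\<exists>k. \<nu>a = k *\<^sub>R G0 a"
    using parallel_if_annihilates_complement[OF F0(4)] F0(5)
      unit_normal_orthogonal_2jet[OF assms(14)] by blast
  then have ne: "?e \<bullet> G0 a \<noteq> 0" using assms(15) by (auto simp: inner_commute)
  \<comment> \<open>The sign of the local equation is chosen such that its gradient points upwards.\<close>
  define \<sigma> where "\<sigma> = sgn (?e \<bullet> G0 a)"
  have \<sigma>: "\<sigma> \<noteq> 0" using ne by (simp add: \<sigma>_def sgn_zero_iff)
  define F where "F = (\<lambda>x. \<sigma> * F0 x)"
  define G where "G = (\<lambda>x. \<sigma> *\<^sub>R G0 x)"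
  have level: "x \<in> S1 \<longleftrightarrow> F x = 0" if "x \<in> U" for x using F0(1)[OF that] \<sigma> by (simp add: F_def)
  have F: "(F has_derivative (\<lambda>v. v \<bullet> G x)) (at x)" if "x \<in> U" for x
    using has_derivative_mult_right[OF F0(2)[OF that], of \<sigma>] by (simp add: F_def G_def)
  have "G differentiable (at a)"
    unfolding G_def using F0(3) by (intro differentiable_scaleR) auto
  then obtain G' where G': "(G has_derivative G') (at a)" by (auto simp: differentiable_def)
  have g: "G a \<noteq> 0" using F0(4) \<sigma> by (simp add: G_def)
  have up: "?e \<bullet> G a > 0"
    using ne by (simp add: G_def \<sigma>_def) (metis abs_sgn mult.commute zero_less_abs_iff)
  have jets1: "\<exists>c. curve_2jet S1 a v c" if "v \<bullet> G a = 0" for v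
    using F0(5) that \<sigma> by (simp add: G_def)
  have "\<forall>\<^sub>F y in nhds b. y \<in> S2 \<longrightarrow> F (y + h *\<^sub>R ?e) \<le> 0"
    by (rule lower_sheet_in_sublevel[OF assms(2) U level assms(6) F up h ab _ assms(9)])
      (use assms(11) in \<open>simp_all add: h_def\<close>)
  then have below: "\<forall>\<^sub>F y in nhds b. y \<in> S2 \<longrightarrow> F (y + h *\<^sub>R ?e) \<le> F (b + h *\<^sub>R ?e)"
    using level[OF U(2)] assms(6) ab by simp
  have U': "b + h *\<^sub>R ?e \<in> U" and G'': "(G has_derivative G') (at (b + h *\<^sub>R ?e))"
    using U(2) G' ab by simp_all
  have touch: "v \<bullet> G a = 0" "c \<bullet> G a + v \<bullet> G' v \<le> 0" if "curve_2jet S2 b v c" for v c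
    using second_order_along_2jet[OF U(1) U' F G'' that below] ab by simp_all
  \<comment> \<open>First-order contact: the tangent hyperplanes at \<open>a\<close> and \<open>b\<close> are parallel, so one basis serves
    for both surfaces.\<close>
  have "\<exists>k. G a = k *\<^sub>R G2 b"
    using parallel_if_annihilates_complement[OF G2(1)] G2(2) touch(1) by blast
  then have jets2: "\<exists>c. curve_2jet S2 b v c" if "v \<bullet> G a = 0" for v
    using G2(2) that g by auto
  have "subspace {v. v \<bullet> G a = 0}"
    by (auto simp: subspace_def inner_add_left)
  then obtain B where B: "pairwise orthogonal B" "\<And>v. v \<in> B \<Longrightarrow> norm v = 1" "independent B"
    "span B = {v. v \<bullet> G a = 0}"
    by (rule orthonormal_basis_subspace) blast
  have fin: "finite B" using B(3) by (rule independent_imp_finite)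
  have tan: "v \<bullet> G a = 0" if "v \<in> B" for v using span_base[OF that] B(4) by auto
  obtain c1 where c1: "\<And>v. v \<in> B \<Longrightarrow> curve_2jet S1 a v (c1 v)"
    using jets1 tan by metis
  obtain c2 where c2: "\<And>v. v \<in> B \<Longrightarrow> curve_2jet S2 b v (c2 v)"
    using jets2 tan by metis
  \<comment> \<open>Second-order contact, direction by direction.\<close>
  have "\<forall>\<^sub>F x in nhds a. x \<in> S1 \<longrightarrow> F x = F a"
    using eventually_nhds_in_open[OF U] by eventually_elim (use level U(2) assms(6) in auto)
  then have "c1 v \<bullet> G a + v \<bullet> G' v = 0" if "v \<in> B" for v
    using second_order_along_2jet_in_level_set[OF U F G' c1[OF that]] by blast
  with touch(2)[OF c2] have "G a \<bullet> c2 v \<le> G a \<bullet> c1 v" if "v \<in> B" for v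
    using that by (force simp: inner_commute)
  then have "(\<Sum>v\<in>B. G a \<bullet> c2 v) \<le> (\<Sum>v\<in>B. G a \<bullet> c1 v)"
    by (rule sum_mono)
  then have "- (b \<bullet> G a) / 2 \<le> - (a \<bullet> G a) / 2"
    using shrinker_acceleration_sum[OF part(1) assms(6) g B(1,2,4) fin jets1 c1]
      shrinker_acceleration_sum[OF part(2) assms(7) g B(1,2,4) fin jets2 c2] by simp
  then have "h * (?e \<bullet> G a) \<le> 0"
    by (subst (asm) (2) ab) (simp add: inner_add_left)
  with h up show False by (simp add: mult_le_0_iff)
qed

end
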